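(* For numbers $x=\Delta^Q_{i_1i_2\ldots i_k\ldots}\in[0,1]$ represented by Cantor series, the generalized shift operator has the following properties. <br>(1) $\sigma\circ\sigma_2^{m}(x)=\sigma^{m+1}(x)$. <br>(2) Suppose $(k_n)$ is a sequence of positive integers such that $k_n=k_{n-1}+1$, $n=2,3,\dots$. Then $$\sigma^{k_n}\circ\sigma_{k_n}\circ\sigma_{k_{n-1}}\circ\ldots\circ\sigma_{k_1}(x)=\sigma^{k_n+n}(x).$$ <br>(3) Suppose $(k_n)$ is an arbitrary finite subsequence of positive integers such that $k_1>k_2>\dots>k_n$. Then $$\sigma^{k_n-n}\circ\sigma_{k_n}\circ\sigma_{k_{n-1}}\circ\ldots\circ\sigma_{k_1}(x)=\sigma^{k_n}(x).$$ <br>(4) The mapping $\sigma_m$ is continuous at each point of the interval $\left(\inf\Delta^Q_{c_1c_2\ldots c_m},\ \sup\Delta^Q_{c_1c_2\ldots c_m}\right)$. The endpoints of $\Delta^Q_{c_1c_2\ldots c_m}$ are points of discontinuity of the mapping. <br>(5) The mapping $\sigma_m$ has a derivative almost everywhere (with respect to the Lebesgue measure). If the mapping has a derivative at the point $x=\Delta^Q_{i_1i_2\ldots i_k\ldots}$, then $(\sigma_m)'=q_m$. <br>(6) $$x-\sigma_m(x)=\frac{i_m}{q_1q_2\cdots q_m}+\frac{\sigma^m(x)}{q_1q_2\cdots q_m}(1-q_m).$$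
   Context: Let $Q=(q_k)$ be a fixed sequence of positive integers with $q_k>1$. For digits $i_k\in\{0,1,\dots,q_k-1\}$ write $$\Delta^Q_{i_1i_2\ldots i_k\ldots}=\sum_{k=1}^{\infty}\frac{i_k}{q_1q_2\cdots q_k}$$ (Cantor series); these represent the numbers of $[0,1]$. Certain numbers, called $Q$-rational, have two different representations: $$\Delta^Q_{i_1i_2\ldots i_{m-1}i_m000\ldots}=\Delta^Q_{i_1i_2\ldots i_{m-1}[i_m-1][q_{m+1}-1][q_{m+2}-1]\ldots}.$$ The cylinder of rank $m$ with base $c_1c_2\ldots c_m$, where $c_j\in\{0,1,\dots,q_j-1\}$, is the set $\Delta^Q_{c_1c_2\ldots c_m}$ of all numbers $x=\Delta^Q_{c_1c_2\ldots c_mi_{m+1}i_{m+2}\ldots}$; it is a closed interval. For a positive integer $m$, the generalized shift operator $\sigma_m$ deletes the $m$-th digit together with the $m$-th term of $Q$: $$\sigma_m(x)=\Delta^{Q\setminus\{q_m\}}_{i_1\ldots i_{m-1}i_{m+1}\ldots}=\sum_{k=1}^{m-1}\frac{i_k}{q_1q_2\cdots q_k}+\sum_{l=m+1}^{\infty}\frac{i_l}{q_1q_2\cdots q_{m-1}q_{m+1}\cdots q_l},$$ where $Q\setminus\{q_m\}$ is the sequence $Q$ without the element $q_m$. In a composition, the next operator acts on the resulting digit sequence and base sequence, with positions renumbered; powers denote iterated composition. The shift operator is $\sigma=\sigma_1$, so that $$\sigma^n\left(\Delta^Q_{i_1i_2\ldots}\right)=\sum_{k=n+1}^{\infty}\frac{i_k}{q_{n+1}q_{n+2}\cdots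 q_k}.$$
   Formalization: In (3) the exponents k_n−n and k_n are replaced by k_1−n and k_1, as the printed identity fails for n≥2; in (4) the left (right) endpoint of the cylinder is a discontinuity exactly if c_m≠0 (c_m≠q_m−1), as σ_m is continuous there otherwise. *)

theory Defs
  imports "HOL-Analysis.Analysis"
begin

text \<open>
  Base sequences and digit sequences are functions on \<^typ>\<open>nat\<close> whose terms are numbered from 1;
  the value at 0 is irrelevant.
\<close>

definition base_seq :: "(nat \<Rightarrow> nat) \<Rightarrow> bool" where
  "base_seq q \<longleftrightarrow> (\<forall>k\<ge>1. q k > 1)"

definition digit_seq :: "(nat \<Rightarrow> nat) \<Rightarrow> (nat \<Rightarrow> nat) \<Rightarrow> bool" where
  "digit_seq q i \<longleftrightarrow> (\<forall>k\<ge>1. i k < q k)"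

definition cantor_series :: "(nat \<Rightarrow> nat) \<Rightarrow> (nat \<Rightarrow> nat) \<Rightarrow> real" where
  "cantor_series q i = (\<Sum>k. real (i (Suc k)) / (\<Prod>j=1..Suc k. real (q j)))"

definition cylinder :: "(nat \<Rightarrow> nat) \<Rightarrow> nat \<Rightarrow> (nat \<Rightarrow> nat) \<Rightarrow> real set" where
  "cylinder q m c = {cantor_series q i |i. digit_seq q i \<and> (\<forall>j\<in>{1..m}. i j = c j)}"

definition delete_term :: "nat \<Rightarrow> (nat \<Rightarrow> nat) \<Rightarrow> nat \<Rightarrow> nat" where
  "delete_term m s = (\<lambda>k. if k < m then s k else s (Suc k))"

text \<open>
  The shift operators act on a pair of a base sequence and a digit sequence, so that a composition
  works on the sequences (and the numbering) left by the preceding operators. The number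
  described by such a pair is \<open>pair_value\<close>.
\<close>

definition gshift :: "nat \<Rightarrow> (nat \<Rightarrow> nat) \<times> (nat \<Rightarrow> nat) \<Rightarrow> (nat \<Rightarrow> nat) \<times> (nat \<Rightarrow> nat)" where
  "gshift m = map_prod (delete_term m) (delete_term m)"

abbreviation shift :: "(nat \<Rightarrow> nat) \<times> (nat \<Rightarrow> nat) \<Rightarrow> (nat \<Rightarrow> nat) \<times> (nat \<Rightarrow> nat)" where
  "shift \<equiv> gshift 1"

definition pair_value :: "(nat \<Rightarrow> nat) \<times> (nat \<Rightarrow> nat) \<Rightarrow> real" where
  "pair_value p = cantor_series (fst p) (snd p)"

text \<open>
  \<open>gshift_seq k n\<close> applies the operator with index \<open>k 1\<close> first and the one with index \<open>k n\<close> last.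
\<close>

definition gshift_seq ::
    "(nat \<Rightarrow> nat) \<Rightarrow> nat \<Rightarrow> (nat \<Rightarrow> nat) \<times> (nat \<Rightarrow> nat) \<Rightarrow> (nat \<Rightarrow> nat) \<times> (nat \<Rightarrow> nat)" where
  "gshift_seq k n = fold gshift (map k [1..<Suc n])"

text \<open>
  Some numbers have two representations, at which the operator may take different values. As a
  function on the unit interval the operator is therefore taken relative to a choice \<open>r\<close> of one
  representation for each number.
\<close>

definition repr_choice :: "(nat \<Rightarrow> nat) \<Rightarrow> (real \<Rightarrow> nat \<Rightarrow> nat) \<Rightarrow> bool" where
  "repr_choice q r \<longleftrightarrow> (\<forall>x\<in>{0..1}. digit_seq q (r x) \<and> cantor_series q (r x) = x)"

definition gshift_map :: "(nat \<Rightarrow> nat) \<Rightarrow> (real \<Rightarrow> nat \<Rightarrow> nat) \<Rightarrow> nat \<Rightarrow> real \<Rightarrow> real" where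
  "gshift_map q r m x = pair_value (gshift m (q, r x))"

end

theory Submission
  imports Defs
begin

text \<open>
  Write \<open>Q\<^sub>n = q 1 * \<dots> * q n\<close>, and for a digit sequence \<open>i\<close> let \<open>J\<^sub>n\<close> be the integer whose digits in the
  mixed radix \<open>q 1, \<dots>, q n\<close> are \<open>i 1, \<dots>, i n\<close>, the most significant first (\<open>prefix_code\<close>). Splitting
  the Cantor series after \<open>m\<close> digits gives \<open>x = (J\<^sub>m + t) / Q\<^sub>m\<close> with \<open>t = \<sigma>\<^sup>m x\<close> in \<open>[0,1]\<close>.
  Deleting the digit \<open>m\<close> leaves the tail \<open>t\<close> alone, so
  \<open>\<sigma>\<^sub>m x = (J\<^bsub>m-1\<^esub> + t) / Q\<^bsub>m-1\<^esub>\<close> (\<open>cantor_series_split\<close>, \<open>pair_value_gshift_Suc\<close>).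
  As \<open>J\<^sub>m = J\<^bsub>m-1\<^esub> * q m + i m\<close>, property (6) is algebra.

  For (4) and (5), put \<open>M = Q\<^sub>m\<close>, \<open>P = Q\<^bsub>m-1\<^esub>\<close> and \<open>d = q m\<close>, so that \<open>M = P * d\<close>. Elimination of
  \<open>t\<close> turns the formula into \<open>\<sigma>\<^sub>m x = (J div d + (M * x - J)) / P\<close> for an integer \<open>J\<close> with
  \<open>J \<le> M * x \<le> J + 1\<close>. Hence \<open>\<sigma>\<^sub>m\<close> consists of affine branches of slope \<open>M / P = d\<close> over the intervals
  \<open>[J / M, (J + 1) / M]\<close>, which are the cylinders of rank \<open>m\<close>. The choice of a representation only
  decides, at a common endpoint, which of the two adjacent branches gives the value. The branches
  \<open>K - 1\<close> and \<open>K\<close> differ by a constant, which is \<open>0\<close> if \<open>d\<close> divides \<open>K\<close> and \<open>1 / P\<close> otherwise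
  (\<open>branch_Suc\<close>). So near \<open>K / M\<close> the map is a single affine function if \<open>d\<close> divides \<open>K\<close>, and it jumps
  there if not. The left endpoint of the cylinder with base \<open>c\<close> has \<open>K = J\<close>, the right one \<open>K = J + 1\<close>,
  where \<open>J mod d = c m\<close>: they are jumps unless \<open>c m = 0\<close> or \<open>c m = d - 1\<close>, respectively. In
  particular the only points without a derivative are jumps, which are finitely many, and every
  derivative is \<open>d\<close>.

  Properties (1), (2) and (3) are one combinatorial fact: when \<open>n\<close> shifts follow, a deletion at a
  position \<open>m \<le> n + 1\<close> only makes the shifts remove one more digit
  (\<open>shift_absorbs_fold_gshift\<close>).
\<close>

section \<open>Compositions of shifts\<close>

lemma pair_value_cong:
  assumes "\<And>k. k \<ge> 1 \<Longrightarrow> fst p k = fst p' k" "\<And>k. k \<ge> 1 \<Longrightarrow> snd p k = snd p' k"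
  shows "pair_value p = pair_value p'"
  using assms by (simp add: pair_value_def cantor_series_def)

lemma delete_first_funpow:
  assumes "k \<ge> 1"
  shows "(delete_term 1 ^^ n) s k = s (k + n)"
  using assms
proof (induction n arbitrary: s)
  case (Suc n)
  have "(delete_term 1 ^^ Suc n) s k = (delete_term 1 ^^ n) (delete_term 1 s) k"
    by (simp only: funpow_Suc_right o_apply)
  also have "\<dots> = delete_term 1 s (k + n)" using Suc by blast
  also have "\<dots> = s (k + Suc n)" using Suc.prems by (simp add: delete_term_def)
  finally show ?case .
qed simp

lemma map_prod_funpow:
  fixes f :: "'a \<Rightarrow> 'a" and g :: "'b \<Rightarrow> 'b"
  shows "map_prod f g ^^ n = map_prod (f ^^ n) (g ^^ n)"
  by (induction n) (auto simp: fun_eq_iff)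

lemma shift_funpow_nth:
  assumes "k \<ge> 1"
  shows "fst ((shift ^^ n) p) k = fst p (k + n)" "snd ((shift ^^ n) p) k = snd p (k + n)"
  using delete_first_funpow[OF assms] by (simp_all add: gshift_def map_prod_funpow)

text \<open>
  The \<open>n\<close> shifts remove the first \<open>n\<close> remaining terms. If the deleted term is at most the
  \<open>n + 1\<close>st, then together they remove exactly the first \<open>n + 1\<close> terms.
\<close>

lemma shift_absorbs_gshift:
  assumes "m \<le> Suc n"
  shows "pair_value ((shift ^^ n) (gshift m p)) = pair_value ((shift ^^ Suc n) p)"
proof (rule pair_value_cong)
  fix k :: nat assume k: "k \<ge> 1"
  show "fst ((shift ^^ n) (gshift m p)) k = fst ((shift ^^ Suc n) p) k"
    unfolding shift_funpow_nth[OF k] using k assms by (simp add: gshift_def delete_term_def)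
  show "snd ((shift ^^ n) (gshift m p)) k = snd ((shift ^^ Suc n) p) k"
    unfolding shift_funpow_nth[OF k] using k assms by (simp add: gshift_def delete_term_def)
qed

text \<open>
  By induction from the end of the list: the last operators are absorbed first and turn into
  further shifts, so the operator \<open>gshift (ms ! j)\<close> meets
  \<open>n + (length ms - j - 1)\<close> shifts when its turn comes.
\<close>

lemma shift_absorbs_fold_gshift:
  assumes "\<And>j. j < length ms \<Longrightarrow> ms ! j \<le> n + (length ms - j)"
  shows "pair_value ((shift ^^ n) (fold gshift ms p)) = pair_value ((shift ^^ (n + length ms)) p)"
  using assms
proof (induction ms arbitrary: p)
  case (Cons a ms)
  have "ms ! j \<le> n + (length ms - j)" if "j < length ms" for j
    using Cons.prems[of "Suc j"] that by simp
  then have "pair_value ((shift ^^ n) (fold gshift (a # ms) p)) =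
      pair_value ((shift ^^ (n + length ms)) (gshift a p))"
    using Cons.IH by simp
  also have "\<dots> = pair_value ((shift ^^ Suc (n + length ms)) p)"
    using Cons.prems[of 0] by (intro shift_absorbs_gshift) simp
  finally show ?case by simp
qed simp

lemma shift_gshift2_funpow:
  "pair_value ((shift \<circ> gshift 2 ^^ m) p) = pair_value ((shift ^^ (m + 1)) p)"
proof -
  have *: "fold gshift (replicate m 2) = gshift 2 ^^ m"
    by (induction m) (simp_all add: funpow_Suc_right del: funpow.simps)
  show ?thesis
    using shift_absorbs_fold_gshift[of "replicate m 2" 1 p] by (simp add: *)
qed

lemma shift_gshift_seq_consecutive:
  assumes "\<forall>j\<ge>2. k j = k (j - 1) + 1"
  shows "pair_value ((shift ^^ k n \<circ> gshift_seq k n) p) = pair_value ((shift ^^ (k n + n)) p)"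
proof -
  have k: "k (Suc j) = k 1 + j" for j
  proof (induction j)
    case (Suc j)
    then show ?case using assms[rule_format, of "Suc (Suc j)"] by simp
  qed simp
  have le: "k (Suc j) \<le> k n" if "j < n" for j
    using k[of j] k[of "n - 1"] that by simp
  have "map k [1..<Suc n] ! j \<le> k n + (length (map k [1..<Suc n]) - j)" if "j < n" for j
    using le[OF that] that by (simp del: upt_Suc)
  then show ?thesis
    using shift_absorbs_fold_gshift[of "map k [1..<Suc n]" "k n" p]
    by (simp add: gshift_seq_def del: upt_Suc)
qed

lemma shift_gshift_seq_decreasing:
  assumes "n \<ge> 1" "k n \<ge> 1" and dec: "\<forall>j\<in>{1..<n}. k j > k (Suc j)"
  shows "pair_value ((shift ^^ (k 1 - n) \<circ> gshift_seq k n) p) = pair_value ((shift ^^ k 1) p)"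
proof -
  have k: "k (Suc j) + j \<le> k 1" if "j < n" for j
    using that
  proof (induction j)
    case (Suc j)
    then show ?case using dec[rule_format, of "Suc j"] by simp
  qed simp
  have n: "n \<le> k 1" using k[of "n - 1"] assms by simp
  have "map k [1..<Suc n] ! j \<le> k 1 - n + (length (map k [1..<Suc n]) - j)" if "j < n" for j
    using that k[OF that] n by (simp del: upt_Suc)
  then show ?thesis
    using n shift_absorbs_fold_gshift[of "map k [1..<Suc n]" "k 1 - n" p]
    by (simp add: gshift_seq_def del: upt_Suc)
qed

section \<open>Values of Cantor series\<close>

definition base_prod :: "(nat \<Rightarrow> nat) \<Rightarrow> nat \<Rightarrow> nat" where
  "base_prod q n = (\<Prod>j=1..n. q j)"

lemma base_prod_0 [simp]: "base_prod q 0 = 1"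
  and base_prod_Suc: "base_prod q (Suc n) = base_prod q n * q (Suc n)"
  by (simp_all add: base_prod_def)

lemma of_nat_base_prod: "real (base_prod q n) = (\<Prod>j=1..n. real (q j))"
  by (simp add: base_prod_def)

lemma base_seq_pos: "base_seq q \<Longrightarrow> k \<ge> 1 \<Longrightarrow> q k > 0"
  by (auto simp: base_seq_def intro: order.strict_trans[OF zero_less_one])

lemma base_seq_tail: "base_seq q \<Longrightarrow> base_seq (\<lambda>k. q (k + n))"
  and digit_seq_tail: "digit_seq q i \<Longrightarrow> digit_seq (\<lambda>k. q (k + n)) (\<lambda>k. i (k + n))"
  by (simp_all add: base_seq_def digit_seq_def)

lemma base_prod_ge: "base_seq q \<Longrightarrow> base_prod q n \<ge> 2 ^ n"
proof (induction n)
  case (Suc n)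
  then have "q (Suc n) \<ge> 2" by (force simp: base_seq_def Suc_le_eq numeral_2_eq_2)
  then show ?case using mult_le_mono[OF Suc.IH[OF Suc.prems], of 2 "q (Suc n)"]
    by (simp add: base_prod_Suc mult.commute)
qed simp

lemma base_prod_pos: "base_seq q \<Longrightarrow> base_prod q n > 0"
  using base_prod_ge[of q n] by (simp add: order_less_le_trans[rotated])

text \<open>
  A series of digits \<open>q k - 1\<close> telescopes (see \<open>cantor_term_maximal\<close>); it dominates every other
  Cantor series, which yields both convergence and the upper bound \<open>1\<close>.
\<close>

lemma maximal_terms_sums_1:
  assumes "base_seq q"
  shows "(\<lambda>k. 1 / real (base_prod q k) - 1 / real (base_prod q (Suc k))) sums 1"
proof -
  have "(\<lambda>k. 1 / real (base_prod q k)) \<longlonglongrightarrow> 0"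
  proof (rule tendsto_sandwich[OF always_eventually _ tendsto_const])
    show "\<forall>\<^sub>F k in sequentially. 1 / real (base_prod q k) \<le> (1 / 2) ^ k"
    proof (rule always_eventually, rule allI)
      fix k
      have "real (2 ^ k) \<le> real (base_prod q k)"
        using base_prod_ge[OF assms] by (simp only: of_nat_le_iff)
      then show "1 / real (base_prod q k) \<le> (1 / 2) ^ k"
        by (simp add: power_one_over frac_le)
    qed
    show "(\<lambda>k. (1 / 2 :: real) ^ k) \<longlonglongrightarrow> 0" by (rule LIMSEQ_power_zero) simp
  qed auto
  from telescope_sums'[OF this] show ?thesis by simp
qed

lemma cantor_term_maximal:
  assumes "base_seq q"
  shows "real (q (Suc k) - 1) / real (base_prod q (Suc k)) =
    1 / real (base_prod q k) - 1 / real (base_prod q (Suc k))"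
proof -
  have "q (Suc k) > 1" using assms by (simp add: base_seq_def)
  then show ?thesis
    using base_prod_pos[OF assms, of k]
    by (simp add: base_prod_Suc of_nat_diff field_simps)
qed

lemma cantor_term_le:
  assumes "base_seq q" "digit_seq q i"
  shows "real (i (Suc k)) / real (base_prod q (Suc k)) \<le>
    1 / real (base_prod q k) - 1 / real (base_prod q (Suc k))"
proof -
  have "i (Suc k) < q (Suc k)" using assms by (simp add: digit_seq_def)
  then have "real (i (Suc k)) \<le> real (q (Suc k) - 1)" by simp
  then show ?thesis
    unfolding cantor_term_maximal[OF assms(1), symmetric] by (rule divide_right_mono) simp
qed

lemma cantor_series_base_prod:
  "cantor_series q i = (\<Sum>k. real (i (Suc k)) / real (base_prod q (Suc k)))"
  by (simp add: cantor_series_def of_nat_base_prod)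

lemma cantor_summable:
  assumes "base_seq q" "digit_seq q i"
  shows "summable (\<lambda>k. real (i (Suc k)) / real (base_prod q (Suc k)))"
  using sums_summable[OF maximal_terms_sums_1[OF assms(1)]]
  by (rule summable_comparison_test'[where N = 0]) (use cantor_term_le[OF assms] in simp)

lemma cantor_series_bounds:
  assumes "base_seq q" "digit_seq q i"
  shows "0 \<le> cantor_series q i" "cantor_series q i \<le> 1"
proof -
  show "0 \<le> cantor_series q i"
    unfolding cantor_series_base_prod by (intro suminf_nonneg cantor_summable assms) simp
  have "cantor_series q i \<le> (\<Sum>k. 1 / real (base_prod q k) - 1 / real (base_prod q (Suc k)))"
    unfolding cantor_series_base_prod
    by (intro suminf_le cantor_term_le cantor_summable assms
          sums_summable[OF maximal_terms_sums_1])
  then show "cantor_series q i \<le> 1"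
    using sums_unique[OF maximal_terms_sums_1[OF assms(1)]] by simp
qed

lemma cantor_series_zero: "cantor_series q (\<lambda>k. 0) = 0"
  by (simp add: cantor_series_def)

lemma cantor_series_maximal: "base_seq q \<Longrightarrow> cantor_series q (\<lambda>k. q k - 1) = 1"
  unfolding cantor_series_base_prod
  using sums_unique[OF maximal_terms_sums_1] by (simp only: cantor_term_maximal)

lemma cantor_series_head:
  assumes "base_seq q" "digit_seq q i"
  shows "cantor_series q i =
    (real (i 1) + cantor_series (\<lambda>k. q (Suc k)) (\<lambda>k. i (Suc k))) / real (q 1)"
proof -
  \<comment> \<open>the recursion of \<open>base_prod\<close> splits off the last factor; here the first one is needed\<close>
  have prod: "base_prod q (Suc n) = q 1 * base_prod (\<lambda>k. q (Suc k)) n" for n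
    by (induction n) (simp_all add: base_prod_Suc)
  have "summable (\<lambda>k. real (i (Suc (Suc k))) / real (base_prod (\<lambda>k. q (Suc k)) (Suc k)))"
    using cantor_summable[OF base_seq_tail[OF assms(1), of 1] digit_seq_tail[OF assms(2), of 1]]
    by simp
  note scaled = suminf_divide[OF this, of "real (q 1)"]
  have "cantor_series q i - real (i 1) / real (q 1) =
      (\<Sum>k. real (i (Suc (Suc k))) / real (base_prod q (Suc (Suc k))))"
    using suminf_split_head[OF cantor_summable[OF assms]]
    by (simp add: cantor_series_base_prod base_prod_Suc)
  also have "\<dots> = cantor_series (\<lambda>k. q (Suc k)) (\<lambda>k. i (Suc k)) / real (q 1)"
    unfolding cantor_series_base_prod scaled[symmetric] prod[of "Suc _"] by (simp add: mult.commute)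
  finally show ?thesis by (simp add: add_divide_distrib)
qed

text \<open>
  Horner evaluation of the first \<open>n\<close> digits. It equals \<open>base_prod q n\<close> times the \<open>n\<close>th partial sum of
  the Cantor series; working with this integer makes the last digit accessible by \<open>div\<close> and \<open>mod\<close>.
\<close>

primrec prefix_code :: "(nat \<Rightarrow> nat) \<Rightarrow> (nat \<Rightarrow> nat) \<Rightarrow> nat \<Rightarrow> nat" where
  "prefix_code q i 0 = 0"
| "prefix_code q i (Suc n) = prefix_code q i n * q (Suc n) + i (Suc n)"

lemma prefix_code_cong:
  assumes "\<And>j. 1 \<le> j \<Longrightarrow> j \<le> n \<Longrightarrow> q j = q' j" "\<And>j. 1 \<le> j \<Longrightarrow> j \<le> n \<Longrightarrow> i j = i' j"
  shows "prefix_code q i n = prefix_code q' i' n"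
  using assms by (induction n) auto

lemma prefix_code_less:
  assumes "\<forall>j\<in>{1..n}. i j < q j"
  shows "prefix_code q i n < base_prod q n"
  using assms
proof (induction n)
  case (Suc n)
  then have "Suc (prefix_code q i n) * q (Suc n) \<le> base_prod q n * q (Suc n)"
    by (intro mult_le_mono1) (simp add: Suc_le_eq)
  moreover have "i (Suc n) < q (Suc n)" using Suc.prems by simp
  ultimately show ?case by (simp add: base_prod_Suc)
qed simp

lemma cantor_series_split:
  assumes "base_seq q" "digit_seq q i"
  shows "cantor_series q i = (real (prefix_code q i n) +
    cantor_series (\<lambda>k. q (k + n)) (\<lambda>k. i (k + n))) / real (base_prod q n)"
proof (induction n)
  case (Suc n)
  have "q (Suc n) > 0" using base_seq_pos[OF assms(1)] by simp
  moreover have "cantor_series (\<lambda>k. q (k + n)) (\<lambda>k. i (k + n)) =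
      (real (i (Suc n)) + cantor_series (\<lambda>k. q (k + Suc n)) (\<lambda>k. i (k + Suc n))) / real (q (Suc n))"
    using cantor_series_head[OF base_seq_tail[OF assms(1)] digit_seq_tail[OF assms(2)], of n]
    by simp
  ultimately show ?case
    using base_prod_pos[OF assms(1), of n] unfolding Suc by (simp add: base_prod_Suc field_simps)
qed simp

lemma pair_value_shift_funpow:
  "pair_value ((shift ^^ n) (q, i)) = cantor_series (\<lambda>k. q (k + n)) (\<lambda>k. i (k + n))"
proof -
  have "pair_value ((shift ^^ n) (q, i)) = pair_value (\<lambda>k. q (k + n), \<lambda>k. i (k + n))"
    by (rule pair_value_cong) (simp_all only: shift_funpow_nth fst_conv snd_conv)
  then show ?thesis by (simp add: pair_value_def)
qed

lemma base_seq_delete_term: "base_seq q \<Longrightarrow> base_seq (delete_term m q)"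
  and digit_seq_delete_term:
    "digit_seq q i \<Longrightarrow> digit_seq (delete_term m q) (delete_term m i)"
  by (simp_all add: base_seq_def digit_seq_def delete_term_def)

text \<open>
  Deleting term \<open>n + 1\<close> keeps the first \<open>n\<close> terms, and what follows them is the original tail after
  \<open>n + 1\<close> terms: both sequences split into the same kind of data, so \<open>cantor_series_split\<close> applies
  to the shortened one.
\<close>

lemma pair_value_gshift_Suc:
  assumes "base_seq q" "digit_seq q i"
  shows "pair_value (gshift (Suc n) (q, i)) = (real (prefix_code q i n) +
    cantor_series (\<lambda>k. q (k + Suc n)) (\<lambda>k. i (k + Suc n))) / real (base_prod q n)"
proof -
  let ?q = "delete_term (Suc n) q" and ?i = "delete_term (Suc n) i"
  have "pair_value (gshift (Suc n) (q, i)) = cantor_series ?q ?i"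
    by (simp add: pair_value_def gshift_def)
  also have "\<dots> = (real (prefix_code ?q ?i n) +
      cantor_series (\<lambda>k. ?q (k + n)) (\<lambda>k. ?i (k + n))) / real (base_prod ?q n)"
    by (intro cantor_series_split base_seq_delete_term digit_seq_delete_term assms)
  also have "prefix_code ?q ?i n = prefix_code q i n"
    by (rule prefix_code_cong) (simp_all add: delete_term_def)
  also have "base_prod ?q n = base_prod q n"
    by (simp add: base_prod_def delete_term_def)
  also have "cantor_series (\<lambda>k. ?q (k + n)) (\<lambda>k. ?i (k + n)) =
      cantor_series (\<lambda>k. q (k + Suc n)) (\<lambda>k. i (k + Suc n))"
    by (simp add: cantor_series_def delete_term_def)
  finally show ?thesis .
qed

lemma diff_gshift:
  assumes "base_seq q" "digit_seq q i" "m \<ge> 1"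
  shows "cantor_series q i - pair_value (gshift m (q, i)) =
    real (i m) / (\<Prod>j=1..m. real (q j)) +
    pair_value ((shift ^^ m) (q, i)) / (\<Prod>j=1..m. real (q j)) * (1 - real (q m))"
proof -
  obtain n where m: "m = Suc n" using assms(3) by (cases m) auto
  have "q (Suc n) > 0" using base_seq_pos[OF assms(1)] by simp
  then show ?thesis
    unfolding m pair_value_shift_funpow pair_value_gshift_Suc[OF assms(1,2)]
      cantor_series_split[OF assms(1,2), of "Suc n"] of_nat_base_prod[symmetric]
    using base_prod_pos[OF assms(1), of n]
    by (simp add: base_prod_Suc field_simps)
qed

section \<open>Endpoints of cylinders\<close>

text \<open>
  On the cylinder only the tail varies. It ranges within \<open>[0,1]\<close>, and both bounds are attained, by the
  tails of zeros and of maximal digits.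
\<close>

lemma cylinder_Inf_Sup:
  assumes "base_seq q" "\<forall>j\<in>{1..m}. c j < q j"
  shows "Inf (cylinder q m c) = real (prefix_code q c m) / real (base_prod q m)"
    and "Sup (cylinder q m c) = real (Suc (prefix_code q c m)) / real (base_prod q m)"
proof -
  let ?tail = "\<lambda>i. cantor_series (\<lambda>k. q (k + m)) (\<lambda>k. i (k + m))"
  have series: "cantor_series q i = (real (prefix_code q c m) + ?tail i) / real (base_prod q m)"
    if "digit_seq q i" "\<forall>j\<in>{1..m}. i j = c j" for i
    using cantor_series_split[OF assms(1) that(1), of m] prefix_code_cong[of m q q i c] that(2)
    by simp
  have bounds: "0 \<le> ?tail i" "?tail i \<le> 1" if "digit_seq q i" for i
    using cantor_series_bounds[OF base_seq_tail[OF assms(1), of m] digit_seq_tail[OF that, of m]]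
    by auto
  \<comment> \<open>the representations of the two endpoints\<close>
  let ?lo = "\<lambda>k. if k \<le> m then c k else 0" and ?hi = "\<lambda>k. if k \<le> m then c k else q k - 1"
  have lo: "digit_seq q ?lo" and hi: "digit_seq q ?hi"
    using assms(2) base_seq_pos[OF assms(1)] by (auto simp: digit_seq_def)
  have tails: "?tail ?lo = ?tail (\<lambda>k. 0)" "?tail ?hi = ?tail (\<lambda>k. q k - 1)"
    by (simp_all add: cantor_series_def)
  have "?tail ?lo = 0" "?tail ?hi = 1"
    unfolding tails using cantor_series_zero cantor_series_maximal[OF base_seq_tail[OF assms(1), of m]]
    by auto
  then have mem: "real (prefix_code q c m) / real (base_prod q m) \<in> cylinder q m c"
      "real (Suc (prefix_code q c m)) / real (base_prod q m) \<in> cylinder q m c"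
    using lo hi series[OF lo] series[OF hi] unfolding cylinder_def
    by (force simp: add.commute)+
  show "Inf (cylinder q m c) = real (prefix_code q c m) / real (base_prod q m)"
    using mem(1) by (rule cInf_eq_minimum)
      (auto simp: cylinder_def series bounds intro!: divide_right_mono)
  show "Sup (cylinder q m c) = real (Suc (prefix_code q c m)) / real (base_prod q m)"
    using mem(2) by (rule cSup_eq_maximum)
      (auto simp: cylinder_def series bounds add.commute intro!: divide_right_mono)
qed

section \<open>Continuity and differentiability of sawtooth functions\<close>

text \<open>
  The affine function that deletes the last digit of \<open>J\<close>: for \<open>x = (J + t) / (P * d)\<close> its value is
  \<open>(J div d + t) / P\<close>.
\<close>

definition branch :: "nat \<Rightarrow> nat \<Rightarrow> nat \<Rightarrow> real \<Rightarrow> real" where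
  "branch P d J x = (real (J div d) + (real (P * d) * x - real J)) / real P"

text \<open>
  Passing to the next interval raises \<open>J\<close> by one, but raises \<open>J div d\<close> only if a carry occurs.
\<close>

lemma branch_Suc:
  "branch P d (Suc J) x = branch P d J x - (if d dvd Suc J then 0 else 1 / real P)"
  by (auto simp: branch_def div_Suc mod_eq_0_iff_dvd diff_divide_distrib add_divide_distrib)

lemma branch_has_derivative:
  assumes "P > 0"
  shows "(branch P d J has_real_derivative real d) (at x within S)"
  unfolding branch_def using assms by (auto intro!: derivative_eq_intros)

text \<open>
  All that matters about \<open>\<sigma>\<^sub>m\<close> for continuity and derivatives: at each point some branch belonging to a
  closed grid interval around the point gives the value. At a grid point either neighbour may do
  so, which covers every choice of representations. The bound \<open>J < P * d\<close> forces the last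
  branch at \<open>x = 1\<close>.
\<close>

locale sawtooth =
  fixes f :: "real \<Rightarrow> real" and P d :: nat
  assumes P: "P > 0" and d: "d > 0"
    and on_branch: "\<And>x. x \<in> {0..1} \<Longrightarrow> \<exists>J<P * d.
      real J \<le> real (P * d) * x \<and> real (P * d) * x \<le> real (Suc J) \<and> f x = branch P d J x"
begin

lemma eq_branch_interior:
  assumes "x \<in> {0..1}" "real J < real (P * d) * x" "real (P * d) * x < real (Suc J)"
  shows "f x = branch P d J x"
proof -
  obtain I where I: "real I \<le> real (P * d) * x" "real (P * d) * x \<le> real (Suc I)"
      "f x = branch P d I x"
    using on_branch[OF assms(1)] by blast
  have "real I < real (Suc J)" "real J < real (Suc I)" using I assms by linarith+
  then have "I = J" by simp
  with I show ?thesis by simp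
qed

text \<open>
  At a multiple \<open>K\<close> of \<open>d\<close> the two adjacent branches are the same function, so the formula holds on
  both sides of the grid point and at the point itself.
\<close>

lemma eq_branch_multiple:
  assumes "x \<in> {0..1}" "d dvd K" "\<bar>real (P * d) * x - real K\<bar> < 1"
  shows "f x = branch P d K x"
proof -
  obtain J where J: "real J \<le> real (P * d) * x" "real (P * d) * x \<le> real (Suc J)"
      "f x = branch P d J x"
    using on_branch[OF assms(1)] by blast
  have "real J < real (Suc K)" "real K < real (Suc (Suc J))" using J assms(3) by linarith+
  then consider "J = K" | "K = Suc J" by linarith
  then show ?thesis
    using J(3) assms(2) branch_Suc[of P d J x] by cases simp_all
qed

lemma has_derivative_of_local_eq_branch:
  assumes "x \<in> {0..1}" "e > 0"
    and "\<And>y. y \<in> {0..1} \<Longrightarrow> \<bar>real (P * d) * y - real (P * d) * x\<bar> < e \<Longrightarrow> f y = branch P d J y"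
  shows "(f has_real_derivative real d) (at x within {0..1})"
proof (rule has_field_derivative_transform_within[OF branch_has_derivative[OF P]])
  have M: "real (P * d) > 0" using P d by simp
  show "0 < e / real (P * d)" using M assms(2) by simp
  fix y :: real assume y: "y \<in> {0..1}" "dist y x < e / real (P * d)"
  have "\<bar>real (P * d) * y - real (P * d) * x\<bar> = real (P * d) * dist y x"
    unfolding right_diff_distrib[symmetric] abs_mult dist_real_def by simp
  also have "\<dots> < e" using y(2) M by (simp add: pos_less_divide_eq mult.commute)
  finally show "branch P d J y = f y" using assms(3)[OF y(1)] by simp
qed fact

lemma has_derivative_interior:
  assumes "x \<in> {0..1}" "real J < real (P * d) * x" "real (P * d) * x < real (Suc J)"
  shows "(f has_real_derivative real d) (at x within {0..1})"
proof (rule has_derivative_of_local_eq_branch[OF assms(1)])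
  \<comment> \<open>the distance from \<open>P * d * x\<close> to the nearest integer\<close>
  let ?e = "min (real (P * d) * x - real J) (real (Suc J) - real (P * d) * x)"
  show "0 < ?e" using assms by simp
  fix y assume "y \<in> {0..1}" "\<bar>real (P * d) * y - real (P * d) * x\<bar> < ?e"
  then show "f y = branch P d J y" by (intro eq_branch_interior) linarith+
qed

lemma has_derivative_multiple:
  assumes "x \<in> {0..1}" "d dvd K" "real (P * d) * x = real K"
  shows "(f has_real_derivative real d) (at x within {0..1})"
  by (rule has_derivative_of_local_eq_branch[OF assms(1), of 1 K])
    (use assms in \<open>auto intro: eq_branch_multiple\<close>)

text \<open>
  Continuity would make \<open>f x\<close> equal to the values at \<open>x\<close> of both adjacent branches, which differ by
  \<open>1 / P\<close>. Both sides of \<open>x\<close> lie in \<open>[0,1]\<close> because \<open>0\<close> and \<open>P * d\<close> are multiples of \<open>d\<close>.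
\<close>

lemma not_continuous_non_multiple:
  assumes "x \<in> {0..1}" "\<not> d dvd K" "real (P * d) * x = real K"
  shows "\<not> continuous (at x within {0..1}) f"
proof
  assume cont: "continuous (at x within {0..1}) f"
  have M: "real (P * d) > 0" using P d by simp
  obtain J where J: "K = Suc J" using assms(2) by (cases K) auto
  have "real K \<le> real (P * d)" using assms(1,3) M mult_left_mono[of x 1 "real (P * d)"]
    by simp
  then have "K \<le> P * d" by (simp only: of_nat_le_iff)
  moreover have "K \<noteq> P * d" using assms(2) by auto
  ultimately have K: "Suc K \<le> P * d" by simp
  \<comment> \<open>the two neighbouring grid points, between which the one-sided limits at \<open>x\<close> are taken\<close>
  define a b where "a = real J / real (P * d)" and "b = real (Suc K) / real (P * d)"
  have Ma: "real (P * d) * a = real J" and Mb: "real (P * d) * b = real (Suc K)"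
    unfolding a_def b_def using M by (simp_all del: of_nat_mult)
  have "real (P * d) * a < real (P * d) * x" "real (P * d) * x < real (P * d) * b"
    unfolding Ma Mb assms(3) J by simp_all
  then have ax: "a < x" and xb: "x < b" using M by (simp_all only: mult_less_cancel_left_pos)
  have "0 \<le> a" by (simp add: a_def)
  have "b \<le> 1" unfolding b_def using K M by (simp only: pos_divide_le_eq mult_1 of_nat_le_iff)
  have branch_lim: "(branch P d I \<longlongrightarrow> branch P d I x) (at x within S)" for I S
    using DERIV_continuous[OF branch_has_derivative[OF P]] by (simp add: continuous_within)
  have lim: "(f \<longlongrightarrow> f x) (at x within {0..1})" using cont by (simp add: continuous_within)
  have "{a..x} \<subseteq> {0..1}" using \<open>0 \<le> a\<close> assms(1) by auto
  then have "(f \<longlongrightarrow> f x) (at_left x)"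
    using tendsto_within_subset[OF lim] at_within_Icc_at_left[OF ax] by metis
  moreover have "\<forall>\<^sub>F y in at_left x. f y = branch P d J y"
    using eventually_at_left_real[OF ax]
  proof eventually_elim
    case (elim y)
    have "real (P * d) * a < real (P * d) * y" "real (P * d) * y < real (P * d) * x"
      using elim M by (simp_all only: mult_less_cancel_left_pos greaterThanLessThan_iff)
    moreover have "y \<in> {0..1}"
      using elim \<open>0 \<le> a\<close> assms(1) unfolding greaterThanLessThan_iff atLeastAtMost_iff by linarith
    ultimately show ?case unfolding Ma assms(3) J by (intro eq_branch_interior)
  qed
  ultimately have "(branch P d J \<longlongrightarrow> f x) (at_left x)"
    by (rule Lim_transform_eventually)
  then have left: "f x = branch P d J x"
    by (rule tendsto_unique[OF trivial_limit_at_left_real _ branch_lim])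
  have "{x..b} \<subseteq> {0..1}" using \<open>b \<le> 1\<close> assms(1) by auto
  then have "(f \<longlongrightarrow> f x) (at_right x)"
    using tendsto_within_subset[OF lim] at_within_Icc_at_right[OF xb] by metis
  moreover have "\<forall>\<^sub>F y in at_right x. f y = branch P d K y"
    using eventually_at_right_real[OF xb]
  proof eventually_elim
    case (elim y)
    have "real (P * d) * x < real (P * d) * y" "real (P * d) * y < real (P * d) * b"
      using elim M by (simp_all only: mult_less_cancel_left_pos greaterThanLessThan_iff)
    moreover have "y \<in> {0..1}"
      using elim \<open>b \<le> 1\<close> assms(1) unfolding greaterThanLessThan_iff atLeastAtMost_iff by linarith
    ultimately show ?case unfolding Mb assms(3) by (intro eq_branch_interior)
  qed
  ultimately have "(branch P d K \<longlongrightarrow> f x) (at_right x)"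
    by (rule Lim_transform_eventually)
  then have "f x = branch P d K x"
    by (rule tendsto_unique[OF trivial_limit_at_right_real _ branch_lim])
  with left show False using branch_Suc[of P d J x] assms(2) P J by simp
qed

lemma continuous_grid_point_iff:
  assumes "K \<le> P * d"
  shows "continuous (at (real K / real (P * d)) within {0..1}) f \<longleftrightarrow> d dvd K"
proof -
  have M: "real (P * d) > 0" using P d by simp
  let ?x = "real K / real (P * d)"
  have "real K \<le> real (P * d)" using assms by (simp only: of_nat_le_iff)
  then have x: "?x \<in> {0..1}" using M by (simp del: of_nat_mult)
  have eq: "real (P * d) * ?x = real K" using M by (simp del: of_nat_mult)
  show ?thesis
    using has_derivative_multiple[OF x _ eq] not_continuous_non_multiple[OF x _ eq] DERIV_continuous
    by blast
qed

lemma grid_cases: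
  assumes "x \<in> {0..1}"
  obtains K where "K \<le> P * d" "real (P * d) * x = real K"
    | J where "real J < real (P * d) * x" "real (P * d) * x < real (Suc J)"
proof -
  obtain J where "J < P * d" "real J \<le> real (P * d) * x" "real (P * d) * x \<le> real (Suc J)"
    using on_branch[OF assms] by blast
  then show ?thesis
    using that(1)[of J] that(1)[of "Suc J"] that(2)[of J] by linarith
qed

text \<open>
  A jump has no derivative, and every other point lies in the relative interior of an affine
  piece of slope \<open>d\<close>.
\<close>

lemma derivative_unique:
  assumes "x \<in> {0..1}" "(f has_real_derivative D) (at x within {0..1})"
  shows "D = real d"
proof -
  have "(f has_real_derivative real d) (at x within {0..1})"
    using assms(1)
  proof (cases rule: grid_cases)
    case (1 K)
    then show ?thesis
      using has_derivative_multiple[OF assms(1) _ 1(2)] DERIV_continuous[OF assms(2)]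
        not_continuous_non_multiple[OF assms(1) _ 1(2)] by argo
  next
    case (2 J)
    then show ?thesis by (rule has_derivative_interior[OF assms(1)])
  qed
  moreover have "at x within {0..1} \<noteq> bot"
    using assms(1) by (simp add: trivial_limit_within islimpt_Icc)
  ultimately show ?thesis
    using has_field_derivative_unique[OF _ assms(2)] by blast
qed

lemma AE_has_derivative:
  "AE x in lebesgue_on {0..1}. (f has_real_derivative real d) (at x within {0..1})"
proof -
  have "negligible ((\<lambda>K. real K / real (P * d)) ` {..P * d})" (is "negligible ?N")
    by (intro negligible_finite) simp
  then have "AE x in lebesgue. x \<notin> ?N"
    by (simp add: negligible_iff_null_sets AE_not_in)
  then have "AE x in lebesgue. x \<in> {0..1} \<longrightarrow> (f has_real_derivative real d) (at x within {0..1})"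
  proof eventually_elim
    case (elim x)
    show ?case
    proof
      assume "x \<in> {0..1}"
      then show "(f has_real_derivative real d) (at x within {0..1})"
      proof (cases rule: grid_cases)
        case (1 K)
        then have "x = real K / real (P * d)" using P d 
          by (simp add: eq_divide_eq mult.commute)
        with 1 elim show ?thesis by blast
      next
        case (2 J)
        then show ?thesis by (rule has_derivative_interior[OF \<open>x \<in> {0..1}\<close>])
      qed
    qed
  qed
  then show ?thesis by (simp add: AE_restrict_space_iff)
qed

end

section \<open>The generalized shift as a function of the number\<close>

text \<open>
  The integer required by the locale is the code of the first \<open>m\<close> digits of the chosen
  representation; integer division by the last base term drops its last digit.
\<close>

lemma sawtooth_gshift_map:
  assumes "base_seq q" "repr_choice q r"
  shows "sawtooth (gshift_map q r (Suc n)) (base_prod q n) (q (Suc n))"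
proof
  show "base_prod q n > 0" by (rule base_prod_pos[OF assms(1)])
  show d: "q (Suc n) > 0" using base_seq_pos[OF assms(1)] by simp
  fix x :: real assume "x \<in> {0..1}"
  then have r: "digit_seq q (r x)" and x: "cantor_series q (r x) = x"
    using assms(2) by (auto simp: repr_choice_def)
  let ?M = "base_prod q n * q (Suc n)" and ?J = "prefix_code q (r x) (Suc n)"
  let ?t = "cantor_series (\<lambda>k. q (k + Suc n)) (\<lambda>k. r x (k + Suc n))"
  have t: "0 \<le> ?t" "?t \<le> 1"
    using cantor_series_bounds[OF base_seq_tail[OF assms(1), of "Suc n"]
        digit_seq_tail[OF r, of "Suc n"]] by auto
  have digit: "r x (Suc n) < q (Suc n)" using r by (simp add: digit_seq_def)
  have "x = (real ?J + ?t) / real ?M"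
    using cantor_series_split[OF assms(1) r, of "Suc n"] x by (simp only: base_prod_Suc)
  moreover have "real ?M \<noteq> 0" using base_prod_pos[OF assms(1), of n] d by simp
  ultimately have Mx: "real ?M * x = real ?J + ?t"
    by (metis nonzero_eq_divide_eq mult.commute)
  have "?J < base_prod q (Suc n)"
    using r by (intro prefix_code_less) (simp add: digit_seq_def)
  moreover have "?J div q (Suc n) = prefix_code q (r x) n" using digit by simp
  then have "gshift_map q r (Suc n) x = branch (base_prod q n) (q (Suc n)) ?J x"
    unfolding gshift_map_def pair_value_gshift_Suc[OF assms(1) r] branch_def Mx by simp
  ultimately show "\<exists>J<?M. real J \<le> real ?M * x \<and> real ?M * x \<le> real (Suc J) \<and>
      gshift_map q r (Suc n) x = branch (base_prod q n) (q (Suc n)) J x"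
    using Mx t by (intro exI[of _ ?J]) (simp add: base_prod_Suc del: prefix_code.simps of_nat_mult)
qed

lemma gshift_map_cylinder:
  assumes "base_seq q" "repr_choice q r" "m \<ge> 1" "\<forall>j\<in>{1..m}. c j < q j"
  shows "\<forall>x\<in>{Inf (cylinder q m c)<..<Sup (cylinder q m c)}.
      continuous (at x within {0..1}) (gshift_map q r m)"
    and "\<not> continuous (at (Inf (cylinder q m c)) within {0..1}) (gshift_map q r m) \<longleftrightarrow> c m \<noteq> 0"
    and "\<not> continuous (at (Sup (cylinder q m c)) within {0..1}) (gshift_map q r m) \<longleftrightarrow>
      c m \<noteq> q m - 1"
proof -
  obtain n where m: "m = Suc n" using assms(3) by (cases m) auto
  interpret sawtooth "gshift_map q r m" "base_prod q n" "q m"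
    unfolding m by (rule sawtooth_gshift_map[OF assms(1,2)])
  let ?J = "prefix_code q c m" and ?M = "base_prod q n * q m"
  have M: "base_prod q m = ?M" by (simp add: m base_prod_Suc)
  have M0: "real ?M > 0" using P d by simp
  have J: "?J < ?M" using prefix_code_less[OF assms(4)] by (simp add: M)
  have cm: "c m < q m" using assms(3,4) by simp
  have J_mod: "?J mod q m = c m" using cm by (simp add: m)
  note ends = cylinder_Inf_Sup[OF assms(1,4), unfolded M]
  show "\<forall>x\<in>{Inf (cylinder q m c)<..<Sup (cylinder q m c)}.
      continuous (at x within {0..1}) (gshift_map q r m)"
  proof
    fix x assume "x \<in> {Inf (cylinder q m c)<..<Sup (cylinder q m c)}"
    then have x: "real ?J < real ?M * x" "real ?M * x < real (Suc ?J)"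
      unfolding ends using M0
      by (auto simp only: greaterThanLessThan_iff pos_divide_less_eq pos_less_divide_eq mult.commute)
    have "0 < real ?M * x" using x(1) by linarith
    moreover have "real (Suc ?J) \<le> real ?M" using J by (simp only: of_nat_le_iff Suc_le_eq)
    with x(2) have "real ?M * x < real ?M * 1" by linarith
    ultimately have "x \<in> {0..1}" using M0
      by (simp only: zero_less_mult_iff mult_less_cancel_left_pos) auto
    then show "continuous (at x within {0..1}) (gshift_map q r m)"
      using has_derivative_interior[OF _ x] DERIV_continuous by blast
  qed
  show "\<not> continuous (at (Inf (cylinder q m c)) within {0..1}) (gshift_map q r m) \<longleftrightarrow> c m \<noteq> 0"
    unfolding ends using continuous_grid_point_iff[of ?J] J J_mod by (simp add: dvd_eq_mod_eq_0)
  \<comment> \<open>adding one to the code produces a carry exactly if its last digit is maximal\<close>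
  have "q m dvd Suc ?J \<longleftrightarrow> c m = q m - 1"
    using cm J_mod by (auto simp: dvd_eq_mod_eq_0 mod_Suc)
  then show "\<not> continuous (at (Sup (cylinder q m c)) within {0..1}) (gshift_map q r m) \<longleftrightarrow>
      c m \<noteq> q m - 1"
    unfolding ends using continuous_grid_point_iff[of "Suc ?J"] J by simp
qed

lemma gshift_map_derivative:
  assumes "base_seq q" "repr_choice q r" "m \<ge> 1"
  shows "AE x in lebesgue_on {0..1}.
      \<exists>D. (gshift_map q r m has_real_derivative D) (at x within {0..1})"
    and "\<forall>x\<in>{0..1}. \<forall>D. (gshift_map q r m has_real_derivative D) (at x within {0..1}) \<longrightarrow>
      D = real (q m)"
proof -
  obtain n where m: "m = Suc n" using assms(3) by (cases m) auto
  interpret sawtooth "gshift_map q r m" "base_prod q n" "q m"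
    unfolding m by (rule sawtooth_gshift_map[OF assms(1,2)])
  show "AE x in lebesgue_on {0..1}.
      \<exists>D. (gshift_map q r m has_real_derivative D) (at x within {0..1})"
    using AE_has_derivative by eventually_elim blast
  show "\<forall>x\<in>{0..1}. \<forall>D. (gshift_map q r m has_real_derivative D) (at x within {0..1}) \<longrightarrow>
      D = real (q m)"
    using derivative_unique by blast
qed

theorem lemma1:
  fixes q :: "nat \<Rightarrow> nat"
  assumes "base_seq q"
  shows
    "(\<forall>i m. digit_seq q i \<and> m \<ge> 1 \<longrightarrow>
        pair_value ((shift \<circ> gshift 2 ^^ m) (q, i)) = pair_value ((shift ^^ (m + 1)) (q, i)))
     \<and>
     (\<forall>i k n. digit_seq q i \<and> (\<forall>j\<ge>1. k j \<ge> 1) \<and> (\<forall>j\<ge>2. k j = k (j - 1) + 1) \<and> n \<ge> 1 \<longrightarrow>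
        pair_value ((shift ^^ k n \<circ> gshift_seq k n) (q, i)) =
        pair_value ((shift ^^ (k n + n)) (q, i)))
     \<and>
     (\<forall>i k n. digit_seq q i \<and> n \<ge> 1 \<and> (\<forall>j\<in>{1..n}. k j \<ge> 1) \<and>
          (\<forall>j\<in>{1..<n}. k j > k (Suc j)) \<longrightarrow>
        pair_value ((shift ^^ (k 1 - n) \<circ> gshift_seq k n) (q, i)) =
        pair_value ((shift ^^ k 1) (q, i)))
     \<and>
     (\<forall>r m c. repr_choice q r \<and> m \<ge> 1 \<and> (\<forall>j\<in>{1..m}. c j < q j) \<longrightarrow>
        (\<forall>x\<in>{Inf (cylinder q m c)<..<Sup (cylinder q m c)}.
           continuous (at x within {0..1}) (gshift_map q r m)) \<and>
        (\<not> continuous (at (Inf (cylinder q m c)) within {0..1}) (gshift_map q r m)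
           \<longleftrightarrow> c m \<noteq> 0) \<and>
        (\<not> continuous (at (Sup (cylinder q m c)) within {0..1}) (gshift_map q r m)
           \<longleftrightarrow> c m \<noteq> q m - 1))
     \<and>
     (\<forall>r m. repr_choice q r \<and> m \<ge> 1 \<longrightarrow>
        (AE x in lebesgue_on {0..1}.
           \<exists>D. (gshift_map q r m has_real_derivative D) (at x within {0..1})) \<and>
        (\<forall>x\<in>{0..1}. \<forall>D. (gshift_map q r m has_real_derivative D) (at x within {0..1})
           \<longrightarrow> D = real (q m)))
     \<and>
     (\<forall>i m. digit_seq q i \<and> m \<ge> 1 \<longrightarrow>
        cantor_series q i - pair_value (gshift m (q, i)) =
          real (i m) / (\<Prod>j=1..m. real (q j)) +
          pair_value ((shift ^^ m) (q, i)) / (\<Prod>j=1..m. real (q j)) * (1 - real (q m)))"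
proof -
  have decreasing: "pair_value ((shift ^^ (k 1 - n) \<circ> gshift_seq k n) p) =
      pair_value ((shift ^^ k 1) p)"
    if "n \<ge> 1" "\<forall>j\<in>{1..n}. k j \<ge> 1" "\<forall>j\<in>{1..<n}. k j > k (Suc j)" for k n p
    using that by (intro shift_gshift_seq_decreasing) auto
  show ?thesis
    apply (intro conjI allI impI)
    subgoal by (rule shift_gshift2_funpow)
    subgoal by (rule shift_gshift_seq_consecutive) blast
    subgoal by (rule decreasing) blast+
    subgoal by (rule gshift_map_cylinder(1)[OF assms]) blast+
    subgoal by (rule gshift_map_cylinder(2)[OF assms]) blast+
    subgoal by (rule gshift_map_cylinder(3)[OF assms]) blast+
    subgoal by (rule gshift_map_derivative(1)[OF assms]) blast+
    subgoal by (rule gshift_map_derivative(2)[OF assms]) blast+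
    subgoal by (rule diff_gshift[OF assms]) blast+
    done
qed

end
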